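(* Let $f:\mathbb{C}\to\mathbb{C}$ be a non-constant entire function, let $\phi\in\mathrm{Aut}(f)$ have a fixed point $z_0\in\mathbb{C}$, and let $n\ge 1$ be an integer such that $f'(z_0)=\ldots=f^{(n-1)}(z_0)=0$ while $f^{(n)}(z_0)\neq 0$ (for $n=1$ the vanishing condition is empty). Then $$\phi'(z_0)\in\left\{e^{2\pi i k/n}\mid k=0,\ldots,n-1\right\}.$$
   Context: An automorphic function of $f$ is a (in general many-valued) analytic function $\phi(z)$ solving the automorphic equation $f(\phi(z))=f(z)$; here a many-valued analytic function is understood as the totality of analytic continuations of a holomorphic function element, and the equation holds for all of its branches. $\mathrm{Aut}(f)$ denotes the set of all automorphic functions of $f$. A fixed point of $\phi$ is a point $z_0\in\mathbb{C}$ such that (a branch of) $\phi$ is holomorphic near $z_0$ with $\phi(z_0)=z_0$; $\phi'(z_0)$ is the derivative of that branch at $z_0$. *)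

theory Defs
  imports "HOL-Complex_Analysis.Complex_Analysis"
begin

type_synonym fun_elem = "complex set \<times> (complex \<Rightarrow> complex)"

text \<open>Only the values of the second component on the domain matter; what it does elsewhere is an
  artefact of functions being total.\<close>

definition function_element :: "fun_elem \<Rightarrow> bool" where
  "function_element e \<longleftrightarrow>
     (case e of (D, g) \<Rightarrow> open D \<and> connected D \<and> D \<noteq> {} \<and> g holomorphic_on D)"

definition direct_continuation :: "fun_elem \<Rightarrow> fun_elem \<Rightarrow> bool" where
  "direct_continuation e e' \<longleftrightarrow>
     function_element e \<and> function_element e' \<and>
     (case e of (D, g) \<Rightarrow> case e' of (E, h) \<Rightarrow>
        D \<inter> E \<noteq> {} \<and> (\<forall>z\<in>D \<inter> E. g z = h z))"

text \<open>The analytic continuations of an element are those reached by finite chains of direct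
  continuations. The totality of them is closed under changing the second component of an element
  outside its domain, so equal sets of elements are the same many-valued function.\<close>

definition totality_of_continuations :: "fun_elem \<Rightarrow> fun_elem set" where
  "totality_of_continuations e = {e'. direct_continuation\<^sup>*\<^sup>* e e'}"

definition many_valued_analytic :: "fun_elem set \<Rightarrow> bool" where
  "many_valued_analytic \<phi> \<longleftrightarrow>
     (\<exists>e. function_element e \<and> \<phi> = totality_of_continuations e)"

definition Aut :: "(complex \<Rightarrow> complex) \<Rightarrow> fun_elem set set" where
  "Aut f = {\<phi>. many_valued_analytic \<phi> \<and> (\<forall>(D, g)\<in>\<phi>. \<forall>z\<in>D. f (g z) = f z)}"

text \<open>Several branches of one many-valued function may be defined near the same point, and only some
  of them may fix it; hence the branch is part of the notion.\<close>

definition fixed_point_via :: "fun_elem set \<Rightarrow> complex \<Rightarrow> fun_elem \<Rightarrow> bool" where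
  "fixed_point_via \<phi> z\<^sub>0 e \<longleftrightarrow> e \<in> \<phi> \<and> z\<^sub>0 \<in> fst e \<and> snd e z\<^sub>0 = z\<^sub>0"

end

theory Submission
  imports Defs
begin

text \<open>Write \<open>f z - f z\<^sub>0 = (z - z\<^sub>0)\<^sup>n h(z)\<close> near \<open>z\<^sub>0\<close> with \<open>h\<close> holomorphic and \<open>h(z\<^sub>0) \<noteq> 0\<close>. If a
  branch \<open>g\<close> fixes \<open>z\<^sub>0\<close>, substituting \<open>g z\<close> into this factorisation and using \<open>f (g z) = f z\<close> gives
  \<open>((g z - z\<^sub>0) / (z - z\<^sub>0))\<^sup>n h(g z) = h(z)\<close> for \<open>z \<noteq> z\<^sub>0\<close>. As \<open>z\<close> tends to \<open>z\<^sub>0\<close>, so does \<open>g z\<close>, and the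
  equation becomes \<open>g'(z\<^sub>0)\<^sup>n h(z\<^sub>0) = h(z\<^sub>0)\<close>; hence \<open>g'(z\<^sub>0)\<close> is an \<open>n\<close>-th root of unity. The argument
  is local (\<open>deriv_fixed_point_power_eq_1\<close>): all it takes from the
  many-valued function is one branch, holomorphic and satisfying the equation near \<open>z\<^sub>0\<close>.\<close>

lemma function_element_of_many_valued_analytic:
  assumes "many_valued_analytic \<phi>" and "e \<in> \<phi>"
  shows "function_element e"
proof -
  obtain e\<^sub>0 where "function_element e\<^sub>0" and "direct_continuation\<^sup>*\<^sup>* e\<^sub>0 e"
    using assms by (auto simp: many_valued_analytic_def totality_of_continuations_def)
  from this(2,1) show ?thesis
    by (induction rule: rtranclp_induct) (auto simp: direct_continuation_def)
qed

text \<open>To leading order, \<open>f\<close> depends on \<open>z\<close> through \<open>(z - z\<^sub>0)\<^sup>n\<close>, while \<open>g\<close> multiplies the displacement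
  \<open>z - z\<^sub>0\<close> by \<open>c\<close>; so \<open>g\<close> can preserve \<open>f\<close> only if \<open>c\<^sup>n = 1\<close>.\<close>

lemma deriv_fixed_point_power_eq_1:
  fixes f g :: "complex \<Rightarrow> complex"
  assumes f: "f holomorphic_on S" "open S" "z\<^sub>0 \<in> S"
    and n: "0 < n"
    and nonvanish: "(deriv ^^ n) f z\<^sub>0 \<noteq> 0"
    and vanish: "\<And>j. 0 < j \<Longrightarrow> j < n \<Longrightarrow> (deriv ^^ j) f z\<^sub>0 = 0"
    and g: "(g has_field_derivative c) (at z\<^sub>0)" "g z\<^sub>0 = z\<^sub>0"
    and invariant: "eventually (\<lambda>z. f (g z) = f z) (nhds z\<^sub>0)"
  shows "c ^ n = 1"
proof -
  obtain h r where r: "0 < r" and h: "h holomorphic_on ball z\<^sub>0 r"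
    and factor: "\<And>w. w \<in> ball z\<^sub>0 r \<Longrightarrow> f w - f z\<^sub>0 = (w - z\<^sub>0) ^ n * h w"
    and h_nonzero: "\<And>w. w \<in> ball z\<^sub>0 r \<Longrightarrow> h w \<noteq> 0"
    using holomorphic_factor_order_of_zero[OF f n nonvanish vanish] by metis
  have h_lim: "(h \<longlongrightarrow> h z\<^sub>0) (nhds z\<^sub>0)"
    using h r holomorphic_on_imp_continuous_on[OF h]
    by (simp add: continuous_on_eq_continuous_at isCont_def tendsto_at_iff_tendsto_nhds)
  have g_lim: "(g \<longlongrightarrow> z\<^sub>0) (at z\<^sub>0)"
    using DERIV_isCont[OF g(1)] g(2) by (simp add: isCont_def)
  have quotient_lim: "((\<lambda>z. (g z - z\<^sub>0) / (z - z\<^sub>0)) \<longlongrightarrow> c) (at z\<^sub>0)"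
    using g by (simp add: has_field_derivative_iff)
  have ball_nhds: "eventually (\<lambda>z. z \<in> ball z\<^sub>0 r) (nhds z\<^sub>0)"
    using r by (intro eventually_nhds_in_open) auto
  have "eventually (\<lambda>z. ((g z - z\<^sub>0) / (z - z\<^sub>0)) ^ n * h (g z) = h z) (at z\<^sub>0)"
  proof -
    have "eventually (\<lambda>z. z \<in> ball z\<^sub>0 r \<and> f (g z) = f z \<and> z \<noteq> z\<^sub>0) (at z\<^sub>0)"
      using ball_nhds invariant by (auto simp: eventually_at_filter elim: eventually_elim2)
    moreover have "eventually (\<lambda>z. g z \<in> ball z\<^sub>0 r) (at z\<^sub>0)"
      by (rule eventually_compose_filterlim[OF ball_nhds g_lim])
    ultimately show ?thesis
    proof eventually_elim
      case (elim z)
      then have "(g z - z\<^sub>0) ^ n * h (g z) = (z - z\<^sub>0) ^ n * h z"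
        using factor[of z] factor[of "g z"] by simp
      with elim show ?case
        by (simp add: field_simps)
    qed
  qed
  moreover have "((\<lambda>z. ((g z - z\<^sub>0) / (z - z\<^sub>0)) ^ n * h (g z)) \<longlongrightarrow> c ^ n * h z\<^sub>0) (at z\<^sub>0)"
    by (intro tendsto_intros quotient_lim filterlim_compose[OF h_lim g_lim])
  ultimately have "(h \<longlongrightarrow> c ^ n * h z\<^sub>0) (at z\<^sub>0)"
    by (rule Lim_transform_eventually[rotated])
  moreover have "(h \<longlongrightarrow> h z\<^sub>0) (at z\<^sub>0)"
    using h_lim by (simp add: tendsto_at_iff_tendsto_nhds)
  ultimately have "c ^ n * h z\<^sub>0 = h z\<^sub>0"
    by (intro tendsto_unique[of "at z\<^sub>0"]) auto
  then show ?thesis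
    using h_nonzero[of z\<^sub>0] r by simp
qed

theorem theorem2p2:
  fixes f :: "complex \<Rightarrow> complex" and \<phi> :: "fun_elem set"
    and z\<^sub>0 :: complex and D :: "complex set" and g :: "complex \<Rightarrow> complex" and n :: nat
  assumes entire: "f holomorphic_on UNIV"
    and nonconst: "\<not> f constant_on UNIV"
    and aut: "\<phi> \<in> Aut f"
    and fixpt: "fixed_point_via \<phi> z\<^sub>0 (D, g)"
    and n: "n \<ge> 1"
    and vanish: "\<And>j. 1 \<le> j \<Longrightarrow> j \<le> n - 1 \<Longrightarrow> (deriv ^^ j) f z\<^sub>0 = 0"
    and nonvanish: "(deriv ^^ n) f z\<^sub>0 \<noteq> 0"
  shows "deriv g z\<^sub>0 \<in>
    {exp (2 * of_real pi * \<i> * of_nat k / of_nat n) | k::nat. k \<in> {0..n - 1}}"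
proof -
  have branch: "(D, g) \<in> \<phi>" "z\<^sub>0 \<in> D" "g z\<^sub>0 = z\<^sub>0"
    using fixpt by (auto simp: fixed_point_via_def)
  have "function_element (D, g)"
    using aut branch(1) function_element_of_many_valued_analytic by (auto simp: Aut_def)
  then have D: "open D" "g holomorphic_on D"
    by (auto simp: function_element_def)
  have "\<forall>z\<in>D. f (g z) = f z"
    using aut branch(1) by (auto simp: Aut_def)
  then have invariant: "eventually (\<lambda>z. f (g z) = f z) (nhds z\<^sub>0)"
    using eventually_nhds_in_open[OF D(1) branch(2)] by (auto elim: eventually_mono)
  have "0 < n"
    using n by simp
  have lower_derivs: "(deriv ^^ j) f z\<^sub>0 = 0" if "0 < j" "j < n" for j
    using that by (intro vanish) linarith+
  have "deriv g z\<^sub>0 ^ n = 1"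
    by (rule deriv_fixed_point_power_eq_1[OF entire open_UNIV UNIV_I \<open>0 < n\<close> nonvanish
          lower_derivs holomorphic_derivI[OF D(2,1) branch(2)] branch(3) invariant])
  then have "deriv g z\<^sub>0 \<in> {exp (2 * of_real pi * \<i> * of_nat k / of_nat n) | k::nat. k < n}"
    using complex_roots_unity[OF n] by blast
  moreover have "k \<in> {0..n - 1} \<longleftrightarrow> k < n" for k
    using n by auto
  ultimately show ?thesis
    by simp
qed

end
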